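(* Let $(V,\#,\ast)$ be a hypervector space over the real hyperfield $\mathbf{R}$, let $\langle\cdot,\cdot\rangle$ be an innerproduct on $V$, and define $f:V\to\mathbb{R}$ by $f(\alpha)=\sqrt{\langle\alpha,\alpha\rangle}$. Then: (i) $f(\alpha)\ge 0$ for all $\alpha\in V$. (ii) For $\alpha\in V$, $f(\alpha)=0$ if and only if $\alpha=\theta$. (iii) $\sup f(a\ast\alpha)\le |a|\,f(\alpha)$ for all $\alpha\in V$ and all $a\in\mathbf{R}$, where $f(a\ast\alpha)=\{f(x): x\in a\ast\alpha\}$. (iv) $\sup f(\alpha\#\beta)\le f(\alpha)+f(\beta)$ for all $\alpha,\beta\in V$, where $f(\alpha\#\beta)=\{f(x): x\in\alpha\#\beta\}$.
   Context: A hyperoperation $\#$ on a non-empty set $X$ is a map from $X\times X$ to the set of non-empty subsets of $X$. Hyperoperations are extended to subsets by unions, e.g. $x\#A=\bigcup_{a\in A}x\#a$, $A\#B=\bigcup_{a\in A,b\in B}a\#b$, and $a\ast A=\bigcup_{x\in A}a\ast x$ for $\ast$ below. $(X,\#)$ is a hypergroup if (i) $a\#(b\#c)=(a\#b)\#c$ for all $a,b,c$; (ii) there is $0\in X$ such that for every $a\in X$ there is a unique $b\in X$ with $0\in a\#b$ and $0\in b\#a$ (write $b=-a$); (iii) $a\in b\#c$ implies $b\in a\#(-c)$. It is commutative if $a\#b=b\#a$ for all $a,b$; then $0$ is unique. A hyperring is a set $X$ with a hyperaddition $\#$ and a (single-valued) multiplication $\cdot$ such that $(X,\#)$ is a commutative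 hypergroup, $(X,\cdot)$ is a semigroup, multiplication distributes over $\#$ on both sides, and $a\cdot 0=0\cdot a=0$ for all $a$. A hyperfield is a hyperring with commutative multiplication, an identity $1$, and such that each non-zero $a$ has an $a^{-1}$ with $a\cdot a^{-1}=1$. Let $(F,\oplus,\cdot)$ be a hyperfield and $(V,\#)$ an (additive) commutative hypergroup with zero vector $\theta$. $V$ is a hypervector space (hyperspace) over $F$ if there is a map $\ast:F\times V\to P^{\ast}(V)$ (non-empty subsets of $V$) such that for all $a,b\in F$, $\alpha,\beta\in V$: (i) $a\ast(\alpha\#\beta)\subseteq a\ast\alpha\,\#\,a\ast\beta$; (ii) $(a\oplus b)\ast\alpha\subseteq a\ast\alpha\,\#\,b\ast\alpha$; (iii) $(a\cdot b)\ast\alpha=a\ast(b\ast\alpha)$; (iv) $(-a)\ast\alpha=a\ast(-\alpha)$; (v) $\alpha\in 1_F\ast\alpha$, $\theta\in 0\ast\alpha$ and $0\ast\theta=\theta$ (that is, $\{\theta\}$). The real hyperfield $\mathbf{R}$ is the hyperfield defined on the set of all real numbers; its elements (with zero $0$, identity $1$ and additive inverses $-a$) are also treated as ordinary real numbers when multiplied with, or compared to, elements of the usual real line $\mathbb{R}$. An innerproduct on a hypervector space $(V,\#,\ast)$ over the real hyperfield $\mathbf{R}$ is a map $\langle\cdot,\cdot\rangle:V\times V\to\mathbb{R}$ (usual reals) such that for all $\alpha,\beta,\gamma\in V$, $a\in\mathbf{R}$: (i) $\langle\alpha,\alpha\rangle>0$ if $\alpha\ne\theta$; (ii) $\langle\alpha,\alpha\rangle=0$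 iff $\alpha=\theta$; (iii) $\langle\alpha,\beta\rangle=\langle\beta,\alpha\rangle$; (iv) $\sup\langle\alpha\#\beta,\gamma\rangle=\langle\alpha,\gamma\rangle+\langle\beta,\gamma\rangle$, where $\langle\alpha\#\beta,\gamma\rangle=\{\langle\delta,\gamma\rangle:\delta\in\alpha\#\beta\}$; (v) $\sup\langle a\ast\alpha,\beta\rangle=a\langle\alpha,\beta\rangle$, where $\langle a\ast\alpha,\beta\rangle=\{\langle\delta,\beta\rangle:\delta\in a\ast\alpha\}$. *)

theory Defs
  imports Complex_Main "HOL-Library.Extended_Real"
begin

definition hyper_ext :: "('a \<Rightarrow> 'b \<Rightarrow> 'c set) \<Rightarrow> 'a set \<Rightarrow> 'b set \<Rightarrow> 'c set" where
  "hyper_ext h A B = (\<Union>a\<in>A. \<Union>b\<in>B. h a b)"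

definition hneg :: "'a set \<Rightarrow> ('a \<Rightarrow> 'a \<Rightarrow> 'a set) \<Rightarrow> 'a \<Rightarrow> 'a \<Rightarrow> 'a" where
  "hneg X add z a = (THE b. b \<in> X \<and> z \<in> add a b \<and> z \<in> add b a)"

text \<open>The element whose existence axiom (ii) of a hypergroup asserts is the parameter
  \<open>zero\<close>; the axioms do not include \<open>add a zero = {a}\<close>.\<close>

locale hypergroup =
  fixes X :: "'a set" and add :: "'a \<Rightarrow> 'a \<Rightarrow> 'a set" and zero :: 'a
  assumes add_closed: "\<lbrakk>a \<in> X; b \<in> X\<rbrakk> \<Longrightarrow> add a b \<subseteq> X"
    and add_nonempty: "\<lbrakk>a \<in> X; b \<in> X\<rbrakk> \<Longrightarrow> add a b \<noteq> {}"
    and add_assoc: "\<lbrakk>a \<in> X; b \<in> X; c \<in> X\<rbrakk> \<Longrightarrow>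
      hyper_ext add {a} (add b c) = hyper_ext add (add a b) {c}"
    and zero_closed: "zero \<in> X"
    and ex1_neg: "a \<in> X \<Longrightarrow> \<exists>!b. b \<in> X \<and> zero \<in> add a b \<and> zero \<in> add b a"
    and reversible: "\<lbrakk>a \<in> X; b \<in> X; c \<in> X; a \<in> add b c\<rbrakk> \<Longrightarrow> b \<in> add a (hneg X add zero c)"

locale comm_hypergroup = hypergroup +
  assumes add_commute: "\<lbrakk>a \<in> X; b \<in> X\<rbrakk> \<Longrightarrow> add a b = add b a"

locale hyperring = comm_hypergroup X add zero
  for X :: "'a set" and add and mult :: "'a \<Rightarrow> 'a \<Rightarrow> 'a" and zero +
  assumes mult_closed: "\<lbrakk>a \<in> X; b \<in> X\<rbrakk> \<Longrightarrow> mult a b \<in> X"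
    and mult_assoc: "\<lbrakk>a \<in> X; b \<in> X; c \<in> X\<rbrakk> \<Longrightarrow> mult a (mult b c) = mult (mult a b) c"
    and distrib_left: "\<lbrakk>a \<in> X; b \<in> X; c \<in> X\<rbrakk> \<Longrightarrow>
      mult a ` add b c = add (mult a b) (mult a c)"
    and distrib_right: "\<lbrakk>a \<in> X; b \<in> X; c \<in> X\<rbrakk> \<Longrightarrow>
      (\<lambda>x. mult x c) ` add a b = add (mult a c) (mult b c)"
    and mult_zero_right: "a \<in> X \<Longrightarrow> mult a zero = zero"
    and mult_zero_left: "a \<in> X \<Longrightarrow> mult zero a = zero"

locale hyperfield = hyperring X add mult zero
  for X :: "'a set" and add and mult and zero and one :: 'a +
  assumes mult_commute: "\<lbrakk>a \<in> X; b \<in> X\<rbrakk> \<Longrightarrow> mult a b = mult b a"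
    and one_closed: "one \<in> X"
    and mult_one: "a \<in> X \<Longrightarrow> mult a one = a"
    and ex_inverse: "\<lbrakk>a \<in> X; a \<noteq> zero\<rbrakk> \<Longrightarrow> \<exists>b\<in>X. mult a b = one"

locale hyperspace =
  field: hyperfield F fadd fmult fzero fone + vec: comm_hypergroup V add \<theta>
  for F :: "'f set" and fadd and fmult and fzero and fone
    and V :: "'v set" and add and \<theta> +
  fixes act :: "'f \<Rightarrow> 'v \<Rightarrow> 'v set"
  assumes act_closed: "\<lbrakk>a \<in> F; \<alpha> \<in> V\<rbrakk> \<Longrightarrow> act a \<alpha> \<subseteq> V"
    and act_nonempty: "\<lbrakk>a \<in> F; \<alpha> \<in> V\<rbrakk> \<Longrightarrow> act a \<alpha> \<noteq> {}"
    and act_add: "\<lbrakk>a \<in> F; \<alpha> \<in> V; \<beta> \<in> V\<rbrakk> \<Longrightarrow>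
      hyper_ext act {a} (add \<alpha> \<beta>) \<subseteq> hyper_ext add (act a \<alpha>) (act a \<beta>)"
    and add_act: "\<lbrakk>a \<in> F; b \<in> F; \<alpha> \<in> V\<rbrakk> \<Longrightarrow>
      hyper_ext act (fadd a b) {\<alpha>} \<subseteq> hyper_ext add (act a \<alpha>) (act b \<alpha>)"
    and mult_act: "\<lbrakk>a \<in> F; b \<in> F; \<alpha> \<in> V\<rbrakk> \<Longrightarrow>
      act (fmult a b) \<alpha> = hyper_ext act {a} (act b \<alpha>)"
    and neg_act: "\<lbrakk>a \<in> F; \<alpha> \<in> V\<rbrakk> \<Longrightarrow>
      act (hneg F fadd fzero a) \<alpha> = act a (hneg V add \<theta> \<alpha>)"
    and one_act: "\<alpha> \<in> V \<Longrightarrow> \<alpha> \<in> act fone \<alpha>"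
    and zero_act: "\<alpha> \<in> V \<Longrightarrow> \<theta> \<in> act fzero \<alpha>"
    and zero_act_zero: "act fzero \<theta> = {\<theta>}"

text \<open>A hyperfield on the set of all reals whose zero, identity and additive inverses are
  the usual ones. The hyperaddition is otherwise arbitrary, and the multiplication is not
  required to be the usual one.\<close>

locale real_hyperfield = hyperfield "UNIV :: real set" radd rmult 0 1
  for radd and rmult +
  assumes hneg_real: "hneg UNIV radd 0 a = - a"

text \<open>Suprema are taken in the extended reals, since \<open>Sup\<close> on \<open>real\<close> is unspecified on sets
  that are unbounded above.\<close>

locale hyper_innerproduct =
  real_hyperfield radd rmult + hyperspace "UNIV :: real set" radd rmult 0 1 V add \<theta> act
  for radd and rmult and V :: "'v set" and add and \<theta> and act +
  fixes ip :: "'v \<Rightarrow> 'v \<Rightarrow> real"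
  assumes ip_pos: "\<lbrakk>\<alpha> \<in> V; \<alpha> \<noteq> \<theta>\<rbrakk> \<Longrightarrow> ip \<alpha> \<alpha> > 0"
    and ip_eq_0_iff: "\<alpha> \<in> V \<Longrightarrow> ip \<alpha> \<alpha> = 0 \<longleftrightarrow> \<alpha> = \<theta>"
    and ip_commute: "\<lbrakk>\<alpha> \<in> V; \<beta> \<in> V\<rbrakk> \<Longrightarrow> ip \<alpha> \<beta> = ip \<beta> \<alpha>"
    and ip_add: "\<lbrakk>\<alpha> \<in> V; \<beta> \<in> V; \<gamma> \<in> V\<rbrakk> \<Longrightarrow>
      (SUP \<delta>\<in>add \<alpha> \<beta>. ereal (ip \<delta> \<gamma>)) = ereal (ip \<alpha> \<gamma> + ip \<beta> \<gamma>)"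
    and ip_act: "\<lbrakk>\<alpha> \<in> V; \<beta> \<in> V\<rbrakk> \<Longrightarrow>
      (SUP \<delta>\<in>act a \<alpha>. ereal (ip \<delta> \<beta>)) = ereal (a * ip \<alpha> \<beta>)"

end

theory Submission
  imports Defs
begin

text \<open>Each element of \<open>a * \<alpha>\<close> or of \<open>\<alpha> # \<beta>\<close> has inner products bounded by the corresponding
  supremum; applying this bound twice to \<open>\<langle>x,x\<rangle>\<close> gives \<open>\<langle>x,x\<rangle> \<le> a\<^sup>2\<langle>\<alpha>,\<alpha>\<rangle>\<close> for \<open>a \<ge> 0\<close>, and
  \<open>\<langle>x,x\<rangle> \<le> \<langle>\<alpha>,\<alpha>\<rangle> + 2\<langle>\<alpha>,\<beta>\<rangle> + \<langle>\<beta>,\<beta>\<rangle>\<close>. Since \<open>(-1) * \<alpha> = 1 * (-\<alpha>)\<close>, comparing suprema yields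
  \<open>\<langle>-\<alpha>,\<beta>\<rangle> = -\<langle>\<alpha>,\<beta>\<rangle>\<close>, which handles negative scalars. The Cauchy-Schwarz inequality follows
  from \<open>\<langle>w,w\<rangle> \<ge> 0\<close> for any \<open>w \<in> u # \<beta>\<close> with \<open>u \<in> t * (-\<alpha>)\<close>.\<close>

lemma (in hypergroup) hneg_closed: "a \<in> X \<Longrightarrow> hneg X add zero a \<in> X"
  unfolding hneg_def using theI'[OF ex1_neg] by blast

context hyper_innerproduct
begin

abbreviation vneg :: "'v \<Rightarrow> 'v" where
  "vneg \<equiv> hneg V add \<theta>"

lemma act_neg: "\<alpha> \<in> V \<Longrightarrow> act (- a) \<alpha> = act a (vneg \<alpha>)"
  using neg_act[of a \<alpha>] by (simp add: hneg_real)

lemma ip_neg: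
  assumes "\<alpha> \<in> V" "\<beta> \<in> V"
  shows "ip (vneg \<alpha>) \<beta> = - ip \<alpha> \<beta>"
  using ip_act[OF assms, of "-1"] ip_act[OF vec.hneg_closed[OF assms(1)] assms(2), of 1]
  by (simp add: act_neg[OF assms(1)])

text \<open>The sign leaves the first argument by \<open>ip_neg\<close> and the second by symmetry,
  so the two signs cancel.\<close>

lemma ip_neg_neg:
  assumes "\<alpha> \<in> V"
  shows "ip (vneg \<alpha>) (vneg \<alpha>) = ip \<alpha> \<alpha>"
proof -
  have n: "vneg \<alpha> \<in> V" using assms by (rule vec.hneg_closed)
  show ?thesis
    using ip_neg[OF assms n] ip_commute[OF assms n] ip_neg[OF assms assms] by linarith
qed

lemma ip_self_nonneg: "\<alpha> \<in> V \<Longrightarrow> 0 \<le> ip \<alpha> \<alpha>"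
  using ip_pos[of \<alpha>] ip_eq_0_iff[of \<alpha>] by (cases "\<alpha> = \<theta>") auto

text \<open>As \<open>act 0 \<theta>\<close> is the singleton of \<theta>, the supremum in
  \<open>ip_act\<close> for the scalar 0 is the inner product itself.\<close>

lemma ip_zero_left:
  assumes "\<beta> \<in> V"
  shows "ip \<theta> \<beta> = 0"
  using ip_act[OF vec.zero_closed assms, of 0] by (simp add: zero_act_zero)

lemma ip_act_le:
  assumes "\<alpha> \<in> V" "\<beta> \<in> V" "x \<in> act a \<alpha>"
  shows "ip x \<beta> \<le> a * ip \<alpha> \<beta>"
  using SUP_upper[OF assms(3), of "\<lambda>\<delta>. ereal (ip \<delta> \<beta>)"] ip_act[OF assms(1,2), of a] by simp

lemma ip_add_le:
  assumes "\<alpha> \<in> V" "\<beta> \<in> V" "\<gamma> \<in> V" "x \<in> add \<alpha> \<beta>"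
  shows "ip x \<gamma> \<le> ip \<alpha> \<gamma> + ip \<beta> \<gamma>"
  using SUP_upper[OF assms(4), of "\<lambda>\<delta>. ereal (ip \<delta> \<gamma>)"] ip_add[OF assms(1-3)] by simp

lemma act_in: "\<alpha> \<in> V \<Longrightarrow> x \<in> act a \<alpha> \<Longrightarrow> x \<in> V"
  using act_closed[of a \<alpha>] by auto

lemma add_in: "\<alpha> \<in> V \<Longrightarrow> \<beta> \<in> V \<Longrightarrow> x \<in> add \<alpha> \<beta> \<Longrightarrow> x \<in> V"
  using vec.add_closed[of \<alpha> \<beta>] by auto

lemma ip_act_self_le_nonneg:
  assumes "\<alpha> \<in> V" "x \<in> act a \<alpha>" "0 \<le> a"
  shows "ip x x \<le> a\<^sup>2 * ip \<alpha> \<alpha>"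
proof -
  have x: "x \<in> V" using assms act_in by blast
  have "ip x x \<le> a * ip x \<alpha>"
    using ip_act_le[OF assms(1) x assms(2)] ip_commute[OF x assms(1)] by simp
  \<comment> \<open>The sign of \<open>a\<close> enters here: the bound on
    \<open>ip x \<alpha>\<close> gets multiplied by \<open>a\<close>.\<close>
  also have "\<dots> \<le> a * (a * ip \<alpha> \<alpha>)"
    using ip_act_le[OF assms(1,1,2)] assms(3) by (rule mult_left_mono)
  finally show ?thesis by (simp add: power2_eq_square mult.assoc)
qed

lemma ip_act_self_le:
  assumes "\<alpha> \<in> V" "x \<in> act a \<alpha>"
  shows "ip x x \<le> a\<^sup>2 * ip \<alpha> \<alpha>"
proof (cases "0 \<le> a")
  case False
  have "x \<in> act (- a) (vneg \<alpha>)"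
    using assms act_neg[of \<alpha> "- a"] by simp
  then show ?thesis
    using ip_act_self_le_nonneg[of "vneg \<alpha>" x "- a"] assms False
    by (simp add: ip_neg_neg vec.hneg_closed)
qed (use ip_act_self_le_nonneg assms in blast)

lemma ip_add_self_le:
  assumes "\<alpha> \<in> V" "\<beta> \<in> V" "x \<in> add \<alpha> \<beta>"
  shows "ip x x \<le> ip \<alpha> \<alpha> + 2 * ip \<alpha> \<beta> + ip \<beta> \<beta>"
proof -
  have x: "x \<in> V" using assms add_in by blast
  show ?thesis
    \<comment> \<open>The bound is used against \<open>x\<close> itself, then against \<alpha> and
      \<beta> to control the two resulting terms.\<close>
    using ip_add_le[OF assms(1,2) x assms(3)] ip_add_le[OF assms(1,2,1,3)]
      ip_add_le[OF assms(1,2,2,3)] ip_commute[OF x assms(1)] ip_commute[OF x assms(2)]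
      ip_commute[OF assms(1,2)]
    by linarith
qed

text \<open>Only upper bounds are available for inner products of elements of a hypersum or
  hyperproduct; they suffice because \<open>ip w w\<close> is nonnegative for any chosen
  \<open>w\<close>.\<close>

lemma ip_quadratic_nonneg:
  assumes "\<alpha> \<in> V" "\<beta> \<in> V" "0 \<le> t"
  shows "0 \<le> t\<^sup>2 * ip \<alpha> \<alpha> + 2 * t * ip \<alpha> \<beta> + ip \<beta> \<beta>"
proof -
  obtain u where u: "u \<in> act t \<alpha>" using act_nonempty[of t \<alpha>] assms by auto
  have uV: "u \<in> V" using u assms act_in by blast
  obtain w where w: "w \<in> add u \<beta>" using vec.add_nonempty[OF uV assms(2)] by auto
  have "0 \<le> ip w w" using w uV assms add_in ip_self_nonneg by blast
  also have "\<dots> \<le> ip u u + 2 * ip u \<beta> + ip \<beta> \<beta>"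
    using uV assms(2) w by (rule ip_add_self_le)
  also have "\<dots> \<le> t\<^sup>2 * ip \<alpha> \<alpha> + 2 * (t * ip \<alpha> \<beta>) + ip \<beta> \<beta>"
    using ip_act_self_le[OF assms(1) u] ip_act_le[OF assms(1,2) u] by linarith
  finally show ?thesis by simp
qed

text \<open>The one-sided form is enough for the triangle inequality.\<close>

lemma ip_cauchy_schwarz:
  assumes "\<alpha> \<in> V" "\<beta> \<in> V"
  shows "ip \<alpha> \<beta> \<le> sqrt (ip \<alpha> \<alpha>) * sqrt (ip \<beta> \<beta>)"
proof (cases "\<alpha> = \<theta> \<or> \<beta> = \<theta>")
  case True
  then have "ip \<alpha> \<beta> = 0"
    using assms ip_zero_left ip_commute by metis
  then show ?thesis using assms by (simp add: ip_self_nonneg)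
next
  case False
  define a b where "a = sqrt (ip \<alpha> \<alpha>)" and "b = sqrt (ip \<beta> \<beta>)"
  have pos: "0 < a" "0 < b"
    using False ip_pos assms by (auto simp: a_def b_def)
  have sq: "ip \<alpha> \<alpha> = a\<^sup>2" "ip \<beta> \<beta> = b\<^sup>2"
    using assms by (simp_all add: a_def b_def ip_self_nonneg)
  \<comment> \<open>Using the negative of \<alpha> flips the cross term. The choice
    \<open>t = b / a\<close> makes both square terms equal to \<open>b\<^sup>2\<close>, so a
    positive factor splits off.\<close>
  have "0 \<le> (b / a)\<^sup>2 * a\<^sup>2 - 2 * (b / a) * ip \<alpha> \<beta> + b\<^sup>2"
    using ip_quadratic_nonneg[OF vec.hneg_closed[OF assms(1)] assms(2), of "b / a"] pos assms
    by (simp add: ip_neg ip_neg_neg sq)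
  also have "\<dots> = 2 * (b / a) * (a * b - ip \<alpha> \<beta>)"
    using pos by (simp add: field_simps power2_eq_square)
  finally have "0 \<le> 2 * (b / a) * (a * b - ip \<alpha> \<beta>)" .
  moreover have "0 < 2 * (b / a)" using pos by simp
  ultimately have "0 \<le> a * b - ip \<alpha> \<beta>"
    by (simp only: zero_le_mult_iff) linarith
  then show ?thesis by (simp add: a_def b_def)
qed

lemma norm_act_le:
  assumes "\<alpha> \<in> V" "x \<in> act a \<alpha>"
  shows "sqrt (ip x x) \<le> \<bar>a\<bar> * sqrt (ip \<alpha> \<alpha>)"
  using real_sqrt_le_mono[OF ip_act_self_le[OF assms]] by (simp add: real_sqrt_mult)

lemma norm_add_le:
  assumes "\<alpha> \<in> V" "\<beta> \<in> V" "x \<in> add \<alpha> \<beta>"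
  shows "sqrt (ip x x) \<le> sqrt (ip \<alpha> \<alpha>) + sqrt (ip \<beta> \<beta>)"
proof (rule real_le_lsqrt)
  show "0 \<le> sqrt (ip \<alpha> \<alpha>) + sqrt (ip \<beta> \<beta>)" using assms by (simp add: ip_self_nonneg)
  show "ip x x \<le> (sqrt (ip \<alpha> \<alpha>) + sqrt (ip \<beta> \<beta>))\<^sup>2"
    \<comment> \<open>Cauchy-Schwarz bounds the cross term by that of the expanded square.\<close>
    using ip_add_self_le[OF assms] ip_cauchy_schwarz[OF assms(1,2)] assms
    by (simp add: power2_sum ip_self_nonneg)
qed

end

theorem mainTheorem1:
  fixes radd :: "real \<Rightarrow> real \<Rightarrow> real set" and rmult :: "real \<Rightarrow> real \<Rightarrow> real"
    and V :: "'v set" and add :: "'v \<Rightarrow> 'v \<Rightarrow> 'v set" and \<theta> :: 'v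
    and act :: "real \<Rightarrow> 'v \<Rightarrow> 'v set" and ip :: "'v \<Rightarrow> 'v \<Rightarrow> real" and f :: "'v \<Rightarrow> real"
  assumes "real_hyperfield radd rmult"
    and "hyperspace UNIV radd rmult 0 1 V add \<theta> act"
    and "hyper_innerproduct radd rmult V add \<theta> act ip"
    and "\<And>\<alpha>. \<alpha> \<in> V \<Longrightarrow> f \<alpha> = sqrt (ip \<alpha> \<alpha>)"
  shows "(\<forall>\<alpha>\<in>V. f \<alpha> \<ge> 0)
    \<and> (\<forall>\<alpha>\<in>V. f \<alpha> = 0 \<longleftrightarrow> \<alpha> = \<theta>)
    \<and> (\<forall>\<alpha>\<in>V. \<forall>a::real. (SUP x\<in>act a \<alpha>. ereal (f x)) \<le> ereal (\<bar>a\<bar> * f \<alpha>))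
    \<and> (\<forall>\<alpha>\<in>V. \<forall>\<beta>\<in>V. (SUP x\<in>add \<alpha> \<beta>. ereal (f x)) \<le> ereal (f \<alpha> + f \<beta>))"
proof -
  interpret hyper_innerproduct radd rmult V add \<theta> act ip by (fact assms(3))
  note f = assms(4)
  show ?thesis
  proof (intro conjI ballI allI SUP_least)
    fix \<alpha> assume "\<alpha> \<in> V"
    then show "f \<alpha> \<ge> 0" and "f \<alpha> = 0 \<longleftrightarrow> \<alpha> = \<theta>"
      by (simp_all add: f ip_self_nonneg ip_eq_0_iff)
  next
    fix \<alpha> a x assume *: "\<alpha> \<in> V" "x \<in> act a \<alpha>"
    show "ereal (f x) \<le> ereal (\<bar>a\<bar> * f \<alpha>)"
      \<comment> \<open>The formula for \<open>f\<close> is given only on \<open>V\<close>, hence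
        the appeal to \<open>act_in\<close>.\<close>
      using norm_act_le[OF *] f[OF *(1)] f[OF act_in[OF *]] by simp
  next
    fix \<alpha> \<beta> x assume *: "\<alpha> \<in> V" "\<beta> \<in> V" "x \<in> add \<alpha> \<beta>"
    show "ereal (f x) \<le> ereal (f \<alpha> + f \<beta>)"
      using norm_add_le[OF *] f[OF *(1)] f[OF *(2)] f[OF add_in[OF *]] by simp
  qed
qed

end
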